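(* Let $\Delta\geq 4$ be an integer, let $G=(V,E)$ be a finite simple undirected graph of maximum degree at most $\Delta$, let $M^*$ be a maximum matching of $G$, and let $M$ be the matching output by any run of the \textsc{1-2-MinGreedy} algorithm on $G$. Then $|M|\geq \frac{\Delta-1}{2\Delta-3}|M^*|$.
   Context: The (deterministic) \textsc{1-2-MinGreedy} algorithm starts with $M=\emptyset$ and repeats until no edges remain in the current graph (initially $G$): if every node has current degree at least $3$, it selects an arbitrary edge $\{u,v\}$; otherwise it selects an arbitrary node $u$ of minimum non-zero current degree and an arbitrary neighbor $v$ of $u$. It then adds $\{u,v\}$ to $M$ and removes all edges incident with $u$ or $v$ from the current graph. All arbitrary choices may be made adversarially; the claim holds for every run. *)

theory Defs
  imports Complex_Main
begin

definition simple_graph :: "'a set \<Rightarrow> 'a set set \<Rightarrow> bool" where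
  "simple_graph V E \<longleftrightarrow> finite V \<and> (\<forall>e\<in>E. e \<subseteq> V \<and> card e = 2)"

definition cdeg :: "'a set set \<Rightarrow> 'a \<Rightarrow> nat" where
  "cdeg F v = card {e \<in> F. v \<in> e}"

definition max_degree_le :: "'a set set \<Rightarrow> nat \<Rightarrow> bool" where
  "max_degree_le E D \<longleftrightarrow> (\<forall>v. cdeg E v \<le> D)"

definition is_matching :: "'a set set \<Rightarrow> 'a set set \<Rightarrow> bool" where
  "is_matching E M \<longleftrightarrow> M \<subseteq> E \<and> (\<forall>e\<in>M. \<forall>f\<in>M. e \<noteq> f \<longrightarrow> e \<inter> f = {})"

definition is_maximum_matching :: "'a set set \<Rightarrow> 'a set set \<Rightarrow> bool" where
  "is_maximum_matching E M \<longleftrightarrow> is_matching E M \<and>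
     (\<forall>M'. is_matching E M' \<longrightarrow> card M' \<le> card M)"

definition mg_choice_ok :: "'a set set \<Rightarrow> 'a set \<Rightarrow> bool" where
  "mg_choice_ok F e \<longleftrightarrow> e \<in> F \<and>
     (if (\<forall>w. 0 < cdeg F w \<longrightarrow> 3 \<le> cdeg F w) then True
      else (\<exists>u v. e = {u, v} \<and> 0 < cdeg F u \<and>
                  (\<forall>w. 0 < cdeg F w \<longrightarrow> cdeg F u \<le> cdeg F w)))"

inductive mingreedy_run :: "'a set set \<Rightarrow> 'a set set \<Rightarrow> bool" where
  run_done: "mingreedy_run {} {}"
| run_step: "\<lbrakk> mg_choice_ok F e; mingreedy_run {f \<in> F. f \<inter> e = {}} M \<rbrakk>
          \<Longrightarrow> mingreedy_run F (insert e M)"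

end

theory Submission
  imports Defs
begin

text \<open>Write $D$ for the degree bound, $U$ for the set of non-isolated vertices of the current graph,
  $N$ for the rest of the competing matching, and $p$ for the number of vertices of degree 1. The
  quantity $2(D-3)|N| + 2|U| - p + (D-2)[p > 0]$ drops by at most $2(2D-3)$ in each step and is $0$
  at the end, so it is at most $2(2D-3)|M|$. When $p = 0$ it is at least $2(D-1)|N|$, because
  $|U| \ge 2|N|$, and this is the claim. When $p > 0$ the next step uses a vertex of degree 1,
  hence destroys at most one edge of $N$, and the claim is inherited from the remaining graph.

  The term $-p$ pays for the vertices that later become isolated, since such a vertex usually has
  degree 1 first. The bonus $D-2$ makes up for the leaves that a step of minimum degree at least 2
  creates; it is lost only once per maximal period in which leaves exist.\<close>

section \<open>Neighbourhoods, degrees and deletion of the ends of an edge\<close>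

abbreviation del_ends :: "'a set set \<Rightarrow> 'a set \<Rightarrow> 'a set set" where
  "del_ends F e \<equiv> {f \<in> F. f \<inter> e = {}}"

definition nbrs :: "'a set set \<Rightarrow> 'a \<Rightarrow> 'a set" where
  "nbrs F v = {w. {v, w} \<in> F}"

definition leaves :: "'a set set \<Rightarrow> 'a set" where
  "leaves F = {v. cdeg F v = 1}"

lemma simple_graph_mono: "simple_graph V F \<Longrightarrow> F' \<subseteq> F \<Longrightarrow> simple_graph V F'"
  by (auto simp: simple_graph_def)

lemma simple_graph_finite: "simple_graph V F \<Longrightarrow> finite F"
  by (meson PowI finite_Pow_iff finite_subset simple_graph_def subsetI)

lemma finite_Union_edges: "simple_graph V F \<Longrightarrow> finite (\<Union>F)"
  unfolding simple_graph_def by (meson Union_least finite_subset)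

lemma edge_neq: "simple_graph V F \<Longrightarrow> {v, w} \<in> F \<Longrightarrow> v \<noteq> w"
  by (auto simp: simple_graph_def)

lemma nbrs_sym: "w \<in> nbrs F v \<longleftrightarrow> v \<in> nbrs F w"
  by (simp add: nbrs_def insert_commute)

lemma edge_obtain:
  assumes "simple_graph V F" "f \<in> F" "v \<in> f"
  obtains w where "f = {v, w}" "w \<in> nbrs F v"
proof -
  have "card f = 2" using assms by (auto simp: simple_graph_def)
  then obtain a b where "f = {a, b}" by (auto simp: card_2_iff)
  with assms that show ?thesis by (auto simp: nbrs_def insert_commute)
qed

lemma Union_edges_iff: "simple_graph V F \<Longrightarrow> v \<in> \<Union>F \<longleftrightarrow> nbrs F v \<noteq> {}"
  by (auto simp: nbrs_def elim: edge_obtain)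

lemma finite_nbrs:
  assumes "simple_graph V F" shows "finite (nbrs F v)"
proof (rule finite_subset)
  show "nbrs F v \<subseteq> \<Union>F" by (auto simp: nbrs_def)
qed (rule finite_Union_edges[OF assms])

text \<open>The map from a neighbour \<open>w\<close> to the edge \<open>{v, w}\<close> is a
  bijection onto the edges at \<open>v\<close>. All later counting uses neighbourhoods, since a
  deletion simply subtracts the two ends from them.\<close>

lemma cdeg_eq_card_nbrs:
  assumes "simple_graph V F"
  shows "cdeg F v = card (nbrs F v)"
proof -
  have "bij_betw (\<lambda>w. {v, w}) (nbrs F v) {f \<in> F. v \<in> f}"
    unfolding bij_betw_def
  proof
    show "inj_on (\<lambda>w. {v, w}) (nbrs F v)"
      by (auto simp: inj_on_def doubleton_eq_iff)
    show "(\<lambda>w. {v, w}) ` nbrs F v = {f \<in> F. v \<in> f}"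
    proof
      show "(\<lambda>w. {v, w}) ` nbrs F v \<subseteq> {f \<in> F. v \<in> f}" by (auto simp: nbrs_def)
      show "{f \<in> F. v \<in> f} \<subseteq> (\<lambda>w. {v, w}) ` nbrs F v"
        by (auto elim: edge_obtain[OF assms])
    qed
  qed
  then show ?thesis by (simp add: cdeg_def bij_betw_same_card)
qed

lemma cdeg_pos_iff:
  assumes "simple_graph V F"
  shows "0 < cdeg F v \<longleftrightarrow> v \<in> \<Union>F"
  using finite_nbrs[OF assms] Union_edges_iff[OF assms]
  by (simp add: cdeg_eq_card_nbrs[OF assms] card_gt_0_iff)

lemma leaves_subset: "simple_graph V F \<Longrightarrow> leaves F \<subseteq> \<Union>F"
  by (metis (mono_tags) cdeg_pos_iff leaves_def mem_Collect_eq subsetI zero_less_one)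

lemma finite_leaves: "simple_graph V F \<Longrightarrow> finite (leaves F)"
  using leaves_subset finite_Union_edges finite_subset by metis

lemma nbrs_del_ends:
  "nbrs (del_ends F {x, y}) v = (if v \<in> {x, y} then {} else nbrs F v - {x, y})"
  by (auto simp: nbrs_def)

section \<open>Matchings\<close>

lemma card_matching_at:
  assumes "is_matching F N"
  shows "card {g \<in> N. v \<in> g} \<le> 1"
proof -
  have "g = h" if "g \<in> {g \<in> N. v \<in> g}" "h \<in> {g \<in> N. v \<in> g}" for g h
    using assms that unfolding is_matching_def by blast
  then have "is_singleton {g \<in> N. v \<in> g} \<or> {g \<in> N. v \<in> g} = {}"
    by (meson equals0I is_singletonI')
  then show ?thesis by (metis card.empty is_singleton_altdef le_refl zero_le_one)
qed

text \<open>Matching edges are disjoint pairs of covered vertices. This is the lower bound on the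
  vertex term of the potential.\<close>

lemma card_matching_vertices:
  assumes "simple_graph V F" "is_matching F N"
  shows "2 * card N \<le> card (\<Union>F)"
proof -
  have N: "N \<subseteq> F" and fin: "finite N"
    using assms simple_graph_finite finite_subset by (auto simp: is_matching_def)
  have c2: "\<And>g. g \<in> N \<Longrightarrow> card g = 2" using assms N by (auto simp: simple_graph_def)
  have "card (\<Union>N) = sum card N"
    by (rule card_Union_disjoint)
      (use assms c2 in \<open>auto simp: is_matching_def pairwise_def disjnt_def intro: card_ge_0_finite\<close>)
  also have "\<dots> = 2 * card N" using c2 by simp
  finally show ?thesis
    using card_mono[OF finite_Union_edges[OF assms(1)], of "\<Union>N"] N by auto
qed

lemma is_matching_del_ends: "is_matching F N \<Longrightarrow> is_matching (del_ends F e) (del_ends N e)"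
  by (auto simp: is_matching_def)

section \<open>Vertices and leaves of the graph after a deletion\<close>

definition newly_isolated :: "'a set set \<Rightarrow> 'a set \<Rightarrow> 'a set" where
  "newly_isolated F e = \<Union>F - \<Union>(del_ends F e) - e"

lemma newly_isolated_iff:
  assumes "simple_graph V F"
  shows "v \<in> newly_isolated F {x, y} \<longleftrightarrow> v \<notin> {x, y} \<and> nbrs F v \<noteq> {} \<and> nbrs F v \<subseteq> {x, y}"
proof -
  have "simple_graph V (del_ends F {x, y})"
    using assms by (rule simple_graph_mono) auto
  from Union_edges_iff[OF this] Union_edges_iff[OF assms] show ?thesis
    unfolding newly_isolated_def nbrs_del_ends by auto
qed

text \<open>A covered vertex disappears either as an end of the chosen edge or because both ends
  contained all its neighbours. Only the second kind varies between steps, so each step analysis has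
  to control it.\<close>

lemma card_Union_del_ends:
  assumes "simple_graph V F" "{x, y} \<in> F"
  shows "card (\<Union>F) = card (\<Union>(del_ends F {x, y})) + card (newly_isolated F {x, y}) + 2"
proof -
  let ?R = "\<Union>(del_ends F {x, y})" and ?I = "newly_isolated F {x, y}"
  have "\<Union>F = ?R \<union> ?I \<union> {x, y}"
    using assms(2) unfolding newly_isolated_def by auto
  moreover have fin: "finite ?R"
    by (rule finite_subset[OF _ finite_Union_edges[OF assms(1)]]) auto
  moreover have finI: "finite (\<Union>F - ?R - {x, y})"
    using finite_Union_edges[OF assms(1)] by blast
  moreover have "card (?R \<union> ?I \<union> {x, y}) = card (?R \<union> ?I) + card {x, y}"
    by (rule card_Un_disjoint)
      (use fin finI in \<open>auto simp: newly_isolated_def\<close>)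
  moreover have "card (?R \<union> ?I) = card ?R + card ?I"
    by (rule card_Un_disjoint)
      (use fin finI in \<open>auto simp: newly_isolated_def\<close>)
  ultimately show ?thesis using edge_neq[OF assms] by simp
qed

text \<open>One of the at most \<open>D\<close> neighbours of \<open>y\<close> is \<open>x\<close>;
  the others are the candidates for leaves created by deleting \<open>y\<close>.\<close>

lemma card_other_nbrs:
  assumes "simple_graph V F" "max_degree_le F D" "{x, y} \<in> F"
  shows "card (nbrs F y - {x}) + 1 \<le> D"
proof -
  have "x \<in> nbrs F y" using assms(3) by (simp add: nbrs_def insert_commute)
  then have "card (nbrs F y) = card (nbrs F y - {x}) + 1"
    using finite_nbrs[OF assms(1)] by (metis Suc_eq_plus1 card_Suc_Diff1)
  moreover have "card (nbrs F y) \<le> D"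
    using assms(2) cdeg_eq_card_nbrs[OF assms(1)] by (simp add: max_degree_le_def)
  ultimately show ?thesis by simp
qed

lemma leaves_del_ends_iff:
  assumes "simple_graph V F"
  shows "v \<in> leaves (del_ends F {x, y}) \<longleftrightarrow> v \<notin> {x, y} \<and> card (nbrs F v - {x, y}) = 1"
proof -
  have "simple_graph V (del_ends F {x, y})"
    using assms by (rule simple_graph_mono) auto
  from cdeg_eq_card_nbrs[OF this] show ?thesis
    unfolding leaves_def nbrs_del_ends by simp
qed

section \<open>Leaves and isolated vertices produced by one step\<close>

lemma card_add_Diff_subset:
  assumes "finite A" "B \<subseteq> A"
  shows "card (A - B) + card B = card A"
  using card_mono[OF assms] card_Diff_subset[OF finite_subset[OF assms(2,1)] assms(2)] by simp

text \<open>A newly isolated vertex was a leaf attached to \<open>y\<close>. It is lost from the old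
  leaves, and it also occupies a place next to \<open>y\<close> where no new leaf can arise; this
  double saving gives the factor 2. The summand 2 comes from \<open>x\<close> in the same way: it is
  a lost leaf and one of the neighbours of \<open>y\<close>.\<close>

lemma leaf_step_count:
  assumes graph: "simple_graph V F" and deg: "max_degree_le F D"
    and edge: "{x, y} \<in> F" and leaf: "cdeg F x = 1"
  shows "card (leaves (del_ends F {x, y})) + 2 * card (newly_isolated F {x, y}) + 2
    \<le> card (leaves F) + D"
proof -
  let ?I = "newly_isolated F {x, y}" and ?B = "nbrs F y - {x}"
  have xy: "y \<in> nbrs F x" "x \<in> nbrs F y"
    using edge by (auto simp: nbrs_def insert_commute)
  have nx: "nbrs F x = {y}"
    using leaf xy unfolding cdeg_eq_card_nbrs[OF graph] by (auto simp: card_1_singleton_iff)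
  have not_x: "x \<notin> nbrs F v" if "v \<noteq> y" for v
    using nx that nbrs_sym by (metis singletonD)
  have I: "?I \<subseteq> ?B \<inter> (leaves F - {x})"
  proof
    fix v assume "v \<in> ?I"
    then have v: "v \<notin> {x, y}" "nbrs F v \<noteq> {}" "nbrs F v \<subseteq> {x, y}"
      by (auto simp: newly_isolated_iff[OF graph])
    with not_x have "nbrs F v = {y}" by blast
    with v(1) show "v \<in> ?B \<inter> (leaves F - {x})"
      using nbrs_sym[of v F y] by (auto simp: leaves_def cdeg_eq_card_nbrs[OF graph])
  qed
  \<comment> \<open>Away from \<open>y\<close> nothing changes, because \<open>x\<close> has no
    other neighbour; so a leaf that is not adjacent to \<open>y\<close> was a leaf before.\<close>
  have "leaves (del_ends F {x, y}) \<subseteq> (leaves F - {x} - ?I) \<union> (?B - ?I)"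
  proof
    fix v assume "v \<in> leaves (del_ends F {x, y})"
    then have v: "v \<notin> {x, y}" "card (nbrs F v - {x, y}) = 1"
      unfolding leaves_del_ends_iff[OF graph] by auto
    then have "v \<notin> ?I" by (auto simp: newly_isolated_iff[OF graph] card_1_singleton_iff)
    moreover have "v \<in> leaves F" if "v \<notin> nbrs F y"
    proof -
      have "y \<notin> nbrs F v" using that nbrs_sym by metis
      then have "nbrs F v - {x, y} = nbrs F v" using not_x v(1) by auto
      with v(2) show ?thesis by (simp add: leaves_def cdeg_eq_card_nbrs[OF graph])
    qed
    ultimately show "v \<in> (leaves F - {x} - ?I) \<union> (?B - ?I)" using v(1) by blast
  qed
  then have "card (leaves (del_ends F {x, y})) \<le> card (leaves F - {x} - ?I) + card (?B - ?I)"
    by (intro order_trans[OF card_mono card_Un_le])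
      (simp_all add: finite_leaves[OF graph] finite_nbrs[OF graph])
  moreover have "card (leaves F - {x} - ?I) + card ?I = card (leaves F - {x})"
    by (rule card_add_Diff_subset) (use I finite_leaves[OF graph] in auto)
  moreover have "card (?B - ?I) + card ?I = card ?B"
    by (rule card_add_Diff_subset) (use I finite_nbrs[OF graph] in auto)
  moreover have "card (leaves F) = card (leaves F - {x}) + 1"
    using leaf card.remove[OF finite_leaves[OF graph], of x] by (simp add: leaves_def)
  moreover have "card ?B + 1 \<le> D" by (rule card_other_nbrs[OF graph deg edge])
  ultimately show ?thesis by linarith
qed

text \<open>Only the second neighbour \<open>a\<close> of \<open>x\<close> and the other neighbours
  of \<open>y\<close> lose an edge. As there are no leaves before the step, a vertex becomes
  isolated only if it is adjacent to both \<open>x\<close> and \<open>y\<close>, and the only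
  candidate is \<open>a\<close>.\<close>

lemma degree_two_step_count:
  assumes graph: "simple_graph V F" and deg: "max_degree_le F D"
    and edge: "{x, y} \<in> F" and two: "cdeg F x = 2" and no_leaf: "leaves F = {}"
  shows "card (leaves (del_ends F {x, y})) + 2 * card (newly_isolated F {x, y}) \<le> D"
    and "card (newly_isolated F {x, y}) \<le> 1"
proof -
  let ?I = "newly_isolated F {x, y}" and ?B = "nbrs F y - {x}"
  have "y \<in> nbrs F x" using edge by (simp add: nbrs_def)
  moreover have "card (nbrs F x) = 2" using two cdeg_eq_card_nbrs[OF graph] by simp
  ultimately have "card (nbrs F x - {y}) = 1" by (simp add: card_Diff_singleton)
  then obtain a where "nbrs F x - {y} = {a}" by (auto simp: card_1_singleton_iff)
  with \<open>y \<in> nbrs F x\<close> have nx: "nbrs F x = {y, a}" by auto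
  have not_one: "card (nbrs F v) \<noteq> 1" for v
    using no_leaf by (auto simp: leaves_def cdeg_eq_card_nbrs[OF graph])
  have I: "?I \<subseteq> {a} \<inter> ?B"
  proof
    fix v assume "v \<in> ?I"
    then have v: "v \<notin> {x, y}" "nbrs F v \<noteq> {}" "nbrs F v \<subseteq> {x, y}"
      by (auto simp: newly_isolated_iff[OF graph])
    moreover have "nbrs F v \<noteq> {x}" "nbrs F v \<noteq> {y}" using not_one[of v] by auto
    ultimately have "nbrs F v = {x, y}" by blast
    then show "v \<in> {a} \<inter> ?B"
      using v(1) nx nbrs_sym[of v F y] nbrs_sym[of v F x] by auto
  qed
  then show "card ?I \<le> 1" using card_mono[of "{a}" ?I] by simp
  have fin: "finite (insert a ?B)" using finite_nbrs[OF graph] by simp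
  have "leaves (del_ends F {x, y}) \<subseteq> insert a ?B - ?I"
  proof
    fix v assume "v \<in> leaves (del_ends F {x, y})"
    then have v: "v \<notin> {x, y}" "card (nbrs F v - {x, y}) = 1"
      unfolding leaves_del_ends_iff[OF graph] by auto
    then have "v \<notin> ?I" by (auto simp: newly_isolated_iff[OF graph] card_1_singleton_iff)
    moreover have "v \<in> insert a ?B"
    proof (rule ccontr)
      assume "v \<notin> insert a ?B"
      then have "x \<notin> nbrs F v" "y \<notin> nbrs F v"
        using v(1) nx nbrs_sym[of v F y] nbrs_sym[of v F x] by auto
      then have "nbrs F v - {x, y} = nbrs F v" by auto
      with v(2) not_one show False by simp
    qed
    ultimately show "v \<in> insert a ?B - ?I" by blast
  qed
  then have leaves': "card (leaves (del_ends F {x, y})) \<le> card (insert a ?B - ?I)"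
    using fin by (intro card_mono) auto
  have B: "card ?B + 1 \<le> D" by (rule card_other_nbrs[OF graph deg edge])
  show "card (leaves (del_ends F {x, y})) + 2 * card ?I \<le> D"
  proof (cases "?I = {}")
    case True
    have "card (insert a ?B) \<le> card ?B + 1"
      using fin by (simp add: card_insert_if)
    with True show ?thesis using leaves' B by simp
  next
    case False
    \<comment> \<open>Now \<open>a\<close> already lies in \<open>?B\<close>, so at most
      \<open>D - 2\<close> new leaves remain, and the weight 2 of the isolated vertex brings the
      total back to \<open>D\<close>.\<close>
    with I have Ia: "?I = {a}" "a \<in> ?B" by auto
    then have "card (insert a ?B - ?I) + 1 = card ?B"
      using card.remove[of ?B a] finite_nbrs[OF graph] by (simp add: insert_absorb)
    then show ?thesis using leaves' B Ia(1) by simp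
  qed
qed

text \<open>A vertex of degree at least 3 loses at most two neighbours. Hence none becomes isolated,
  and a new leaf must be adjacent to both ends; counting such vertices among the neighbours of
  \<open>y\<close> suffices.\<close>

lemma degree_three_step_count:
  assumes graph: "simple_graph V F" and deg: "max_degree_le F D"
    and edge: "{x, y} \<in> F" and three: "\<And>v. v \<in> \<Union>F \<Longrightarrow> 3 \<le> cdeg F v"
  shows "newly_isolated F {x, y} = {}"
    and "card (leaves (del_ends F {x, y})) + 1 \<le> D"
proof -
  have nb3: "3 \<le> card (nbrs F v)" if "nbrs F v \<noteq> {}" for v
    using three[of v] that unfolding Union_edges_iff[OF graph] cdeg_eq_card_nbrs[OF graph] .
  have c2: "card {x, y} \<le> 2" by (rule card_insert_le_m1) auto
  show "newly_isolated F {x, y} = {}"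
  proof (rule equals0I)
    fix v assume "v \<in> newly_isolated F {x, y}"
    then have "nbrs F v \<noteq> {}" "nbrs F v \<subseteq> {x, y}"
      by (auto simp: newly_isolated_iff[OF graph])
    then show False
      using nb3[of v] c2 card_mono[of "{x, y}" "nbrs F v"] by simp
  qed
  have "leaves (del_ends F {x, y}) \<subseteq> nbrs F y - {x}"
  proof
    fix v assume "v \<in> leaves (del_ends F {x, y})"
    then have v: "v \<notin> {x, y}" "card (nbrs F v - {x, y}) = 1"
      unfolding leaves_del_ends_iff[OF graph] by auto
    have "y \<in> nbrs F v"
    proof (rule ccontr)
      assume "y \<notin> nbrs F v"
      then have "nbrs F v \<subseteq> insert x (nbrs F v - {x, y})" by auto
      then have "card (nbrs F v) \<le> card (insert x (nbrs F v - {x, y}))"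
        using finite_nbrs[OF graph] by (intro card_mono) auto
      also have "\<dots> \<le> 2" using v(2) finite_nbrs[OF graph] by (simp add: card_insert_if)
      moreover have "nbrs F v \<noteq> {}" using v(2) by auto
      ultimately show False using nb3[of v] by simp
    qed
    with v(1) show "v \<in> nbrs F y - {x}" using nbrs_sym[of v F y] by auto
  qed
  then have "card (leaves (del_ends F {x, y})) \<le> card (nbrs F y - {x})"
    using finite_nbrs[OF graph] by (intro card_mono) auto
  then show "card (leaves (del_ends F {x, y})) + 1 \<le> D"
    using card_other_nbrs[OF graph deg edge] by simp
qed

section \<open>Matching edges destroyed by one step\<close>

lemma matching_edges_hit_le_2:
  assumes "is_matching F N"
  shows "card {g \<in> N. g \<inter> {x, y} \<noteq> {}} \<le> 2"
proof -
  have "{g \<in> N. g \<inter> {x, y} \<noteq> {}} = {g \<in> N. x \<in> g} \<union> {g \<in> N. y \<in> g}" by auto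
  then show ?thesis
    using card_Un_le[of "{g \<in> N. x \<in> g}" "{g \<in> N. y \<in> g}"]
      card_matching_at[OF assms, of x] card_matching_at[OF assms, of y] by simp
qed

text \<open>The only edge at the leaf \<open>x\<close> is \<open>{x, y}\<close>, so every matching
  edge that is hit contains \<open>y\<close>.\<close>

lemma matching_edges_hit_leaf:
  assumes graph: "simple_graph V F" and N: "is_matching F N"
    and edge: "{x, y} \<in> F" and leaf: "cdeg F x = 1"
  shows "card {g \<in> N. g \<inter> {x, y} \<noteq> {}} \<le> 1"
proof -
  have "y \<in> nbrs F x" using edge by (simp add: nbrs_def)
  then have nx: "nbrs F x = {y}"
    using leaf unfolding cdeg_eq_card_nbrs[OF graph] by (auto simp: card_1_singleton_iff)
  have "y \<in> g" if g: "g \<in> N" "x \<in> g" for g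
  proof -
    have "g \<in> F" using N g by (auto simp: is_matching_def)
    from graph this g(2) obtain w where "g = {x, w}" "w \<in> nbrs F x"
      by (rule edge_obtain)
    with nx show ?thesis by simp
  qed
  then have "{g \<in> N. g \<inter> {x, y} \<noteq> {}} = {g \<in> N. y \<in> g}" by auto
  then show ?thesis using card_matching_at[OF N, of y] by simp
qed

text \<open>The ends are named so that \<open>x\<close> has minimum degree in the first two cases.
  Minimality of degree 2 excludes leaves, which is recorded because the potential then carries no
  bonus.\<close>

lemma mg_choice_cases:
  assumes graph: "simple_graph V F" and ok: "mg_choice_ok F e"
  obtains x y where "e = {x, y}" "{x, y} \<in> F" "cdeg F x = 1"
    | x y where "e = {x, y}" "{x, y} \<in> F" "cdeg F x = 2" "leaves F = {}"
    | x y where "e = {x, y}" "{x, y} \<in> F" "\<And>v. v \<in> \<Union>F \<Longrightarrow> 3 \<le> cdeg F v" "leaves F = {}"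
proof -
  have eF: "e \<in> F" using ok by (simp add: mg_choice_ok_def)
  show ?thesis
  proof (cases "\<forall>w. 0 < cdeg F w \<longrightarrow> 3 \<le> cdeg F w")
    case True
    have "card e = 2" using eF graph by (simp add: simple_graph_def)
    then obtain x y where e: "e = {x, y}" by (auto simp: card_2_iff)
    have "cdeg F v \<noteq> 1" for v using True[rule_format, of v] by auto
    then have "leaves F = {}" by (simp add: leaves_def)
    moreover have "3 \<le> cdeg F v" if "v \<in> \<Union>F" for v
      using True that cdeg_pos_iff[OF graph] by blast
    ultimately show ?thesis using that(3)[OF e] eF e by simp
  next
    case False
    then obtain w where w: "0 < cdeg F w" "cdeg F w < 3" by (auto simp: not_le)
    have "\<exists>x y. e = {x, y} \<and> 0 < cdeg F x \<and> (\<forall>w. 0 < cdeg F w \<longrightarrow> cdeg F x \<le> cdeg F w)"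
      using ok unfolding mg_choice_ok_def if_not_P[OF False] by (rule conjunct2)
    then obtain x y where e: "e = {x, y}" and pos: "0 < cdeg F x"
      and min: "\<And>w. 0 < cdeg F w \<Longrightarrow> cdeg F x \<le> cdeg F w" by blast
    have xy: "{x, y} \<in> F" using eF e by simp
    have "cdeg F x \<le> 2" using min[OF w(1)] w(2) by simp
    with pos consider "cdeg F x = 1" | "cdeg F x = 2" by linarith
    then show ?thesis
    proof cases
      case 1
      then show ?thesis by (rule that(1)[OF e xy])
    next
      case 2
      then have "cdeg F v \<noteq> 1" for v using min[of v] by auto
      then have "leaves F = {}" by (simp add: leaves_def)
      then show ?thesis by (rule that(2)[OF e xy 2])
    qed
  qed
qed

section \<open>The potential and the induction over a run\<close>

definition graph_potential :: "nat \<Rightarrow> 'a set set \<Rightarrow> int" where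
  "graph_potential D F = 2 * int (card (\<Union>F)) - int (card (leaves F))
     + (if leaves F = {} then 0 else int D - 2)"

lemma mingreedy_run_subset: "mingreedy_run F M \<Longrightarrow> M \<subseteq> F"
  by (induction rule: mingreedy_run.induct) (auto simp: mg_choice_ok_def)

text \<open>Both bounds are proved together: without leaves the second follows from the first,
  whereas with leaves the potential may be too small and the second is inherited from the remaining
  graph. \<open>N\<close> is an arbitrary matching because the rest of a maximum matching need not
  be maximum after a step.\<close>

lemma mingreedy_run_bounds:
  assumes "mingreedy_run F M" "simple_graph V F" "max_degree_le F D" "is_matching F N" "3 \<le> D"
  shows "2 * (int D - 3) * int (card N) + graph_potential D F \<le> 2 * (2 * int D - 3) * int (card M)
    \<and> (int D - 1) * int (card N) \<le> (2 * int D - 3) * int (card M)"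
  using assms
proof (induction arbitrary: N rule: mingreedy_run.induct)
  case run_done
  then show ?case by (auto simp: is_matching_def graph_potential_def leaves_def cdeg_def)
next
  case (run_step F e M)
  let ?F = "del_ends F e" and ?N = "del_ends N e" and ?H = "{g \<in> N. g \<inter> e \<noteq> {}}"
  let ?i = "card (newly_isolated F e)"
  note graph = run_step.prems(1) and deg = run_step.prems(2) and N = run_step.prems(3)
  have graph': "simple_graph V ?F" using graph by (rule simple_graph_mono) auto
  have "max_degree_le ?F D"
    unfolding max_degree_le_def
  proof
    fix v
    have "cdeg ?F v \<le> cdeg F v"
      using simple_graph_finite[OF graph] by (auto simp: cdeg_def intro: card_mono)
    then show "cdeg ?F v \<le> D" using deg by (meson max_degree_le_def order_trans)
  qed
  note IH = run_step.IH[OF graph' this is_matching_del_ends[OF N] \<open>3 \<le> D\<close>]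
  have "e \<in> F" using run_step.hyps(1) by (simp add: mg_choice_ok_def)
  then have "e \<noteq> {}" using graph by (auto simp: simple_graph_def)
  \<comment> \<open>The later edges all avoid the nonempty set \<open>e\<close>, so inserting
    \<open>e\<close> really increases the cardinality.\<close>
  have "M \<subseteq> ?F" using run_step.hyps(2) by (rule mingreedy_run_subset)
  then have "e \<notin> M" "finite M"
    using \<open>e \<noteq> {}\<close> finite_subset[OF _ simple_graph_finite[OF graph']] by auto
  then have M: "card (insert e M) = card M + 1" by simp
  have finN: "finite N"
    using N finite_subset[OF _ simple_graph_finite[OF graph]] by (auto simp: is_matching_def)
  have cN: "card N = card ?N + card ?H"
  proof -
    have "N = ?N \<union> ?H" by auto
    then show ?thesis using card_Un_disjoint[of ?N ?H] finN by auto
  qed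
  have vertices: "2 * card N \<le> card (\<Union>F)"
    by (rule card_matching_vertices[OF graph N])
  have min_degree_2_case: ?case
    if U: "card (\<Union>F) = card (\<Union>?F) + ?i + 2" and noleaf: "leaves F = {}" and H: "card ?H \<le> 2"
      and count: "card (leaves ?F) + 2 * ?i \<le> D" and i: "?i \<le> 1"
  proof -
    have "(int D - 3) * int (card ?H) \<le> (int D - 3) * 2"
      using H \<open>3 \<le> D\<close> by (intro mult_left_mono) auto
    \<comment> \<open>If no leaf arises, \<open>?i\<close> is at most 1; otherwise the new bonus
      \<open>D - 2\<close> offsets the bound \<open>D\<close>. So the graph term drops by at most 4
      + 2, and two lost matching edges add \<open>4 * (D - 3)\<close>, giving
      \<open>2 * (2 * D - 3)\<close>.\<close>
    moreover have "2 * int ?i + int (card (leaves ?F))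
        - (if leaves ?F = {} then 0 else int D - 2) \<le> 2"
      using count i by auto
    ultimately have A: "2 * (int D - 3) * int (card N) + graph_potential D F
        \<le> 2 * (2 * int D - 3) * int (card (insert e M))"
      using IH U noleaf unfolding graph_potential_def cN M by (simp add: algebra_simps)
    \<comment> \<open>Without leaves the graph term is at least \<open>4 * card N\<close>, which
      raises the coefficient \<open>2 * (D - 3)\<close> to \<open>2 * (D - 1)\<close>.\<close>
    moreover have "2 * (int D - 1) * int (card N)
        \<le> 2 * (int D - 3) * int (card N) + graph_potential D F"
      using vertices noleaf by (simp add: graph_potential_def algebra_simps)
    ultimately show ?thesis by (simp add: algebra_simps)
  qed
  from graph run_step.hyps(1) show ?case
  proof (cases rule: mg_choice_cases)
    case (1 x y)
    note count = leaf_step_count[OF graph deg 1(2,3), folded 1(1)]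
    note U = card_Union_del_ends[OF graph 1(2), folded 1(1)]
    note H = matching_edges_hit_leaf[OF graph N 1(2,3), folded 1(1)]
    have leaf: "leaves F \<noteq> {}" using 1(3) by (auto simp: leaves_def)
    \<comment> \<open>The graph term drops by at most 4 for the two ends, \<open>D - 2\<close> by
      \<open>count\<close>, and \<open>D - 2\<close> for a lost bonus; one matching edge adds
      \<open>2 * (D - 3)\<close>, again \<open>2 * (2 * D - 3)\<close> in total. For the second
      bound, the loss \<open>D - 1\<close> is at most \<open>2 * D - 3\<close>.\<close>
    have "(int D - 3) * int (card ?H) \<le> (int D - 3) * 1"
      "(int D - 1) * int (card ?H) \<le> (int D - 1) * 1"
      using H \<open>3 \<le> D\<close> by (intro mult_left_mono; simp)+
    moreover have "0 \<le> (if leaves ?F = {} then 0 else int D - 2)" using \<open>3 \<le> D\<close> by simp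
    ultimately show ?thesis
      using IH U leaf count \<open>3 \<le> D\<close> unfolding graph_potential_def cN M by (simp add: algebra_simps)
  next
    case (2 x y)
    show ?thesis
      unfolding 2(1)
      by (rule min_degree_2_case[unfolded 2(1)])
        (use card_Union_del_ends[OF graph 2(2)] 2(4) matching_edges_hit_le_2[OF N, of x y]
          degree_two_step_count[OF graph deg 2(2-4)] in simp_all)
  next
    case (3 x y)
    show ?thesis
      unfolding 3(1)
      by (rule min_degree_2_case[unfolded 3(1)])
        (use card_Union_del_ends[OF graph 3(2)] 3(4) matching_edges_hit_le_2[OF N, of x y]
          degree_three_step_count[OF graph deg 3(2,3)] in simp_all)
  qed
qed

theorem theorem2:
  fixes V :: "'a set" and E :: "'a set set" and \<Delta> :: nat
    and Mstar M :: "'a set set"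
  assumes "4 \<le> \<Delta>"
    and "simple_graph V E"
    and "max_degree_le E \<Delta>"
    and "is_maximum_matching E Mstar"
    and "mingreedy_run E M"
  shows "real (card M) \<ge> (real \<Delta> - 1) / (2 * real \<Delta> - 3) * real (card Mstar)"
proof -
  have "is_matching E Mstar" using assms(4) by (simp add: is_maximum_matching_def)
  then have "(int \<Delta> - 1) * int (card Mstar) \<le> (2 * int \<Delta> - 3) * int (card M)"
    using mingreedy_run_bounds[OF assms(5,2,3)] assms(1) by simp
  then have "real_of_int ((int \<Delta> - 1) * int (card Mstar)) \<le> of_int ((2 * int \<Delta> - 3) * int (card M))"
    by (simp only: of_int_le_iff)
  then have "(real \<Delta> - 1) * real (card Mstar) \<le> (2 * real \<Delta> - 3) * real (card M)" by simp
  then show ?thesis using assms(1) by (simp add: field_simps)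
qed

end
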